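(* Let $A\subset\mathbb{R}^m$, $B\subset\mathbb{R}^n$, and let $x\in\overline A$, $y\in\overline B$. Then \[ \dim_{\times}\{x\}_A+\dim_{\times}\{y\}_B\ \le\ \dim_{\times}\{(x,y)\}_{A\times B}\ \le\ \dim_{\mathrm{Ptan}}\{x\}_A+\dim_{\mathrm{Ptan}}\{y\}_B. \]
   Context: $A\times B$ is regarded as a subset of $\mathbb{R}^m\times\mathbb{R}^n\simeq\mathbb{R}^{m+n}$. The following definitions are for subsets $A$ of a Euclidean space $\mathbb{R}^n$ of any dimension $n$. Tangent cone: $\mathrm{Tan}_x(A)$ is the set of $v\in\mathbb{R}^n$ for which there exist $x_k\in A$, $x_k\to x$, and positive reals $\lambda_k\downarrow0$ with $(x_k-x)/\lambda_k\to v$. Point-tangential dimension: $\dim_{\mathrm{Ptan}}\{x\}_A:=\dim\mathrm{span}(\mathrm{Tan}_x(A))$, with $\mathrm{span}(\varnothing)=\{0\}$. Effective directions: $\mathrm{Eff}_x(A):=\mathrm{Tan}_x(A)\cap S^{n-1}$ if $x\in\overline A$ (and $\varnothing$ otherwise). For $v\ne0$ let $[v]=\mathbb{R}v\in\mathbb{P}^{n-1}$; $\mathrm{Eff}_x^{\mathbb P}(A):=\{[v]:v\in\mathrm{Eff}_x(A)\}$. Admissible probes: for $x\in\overline A$, $v\in S^{n-1}$, $\mathcal G_x^A(v)$ is the family of all injective Lipschitz maps $\gamma:[0,\delta]\to\mathbb{R}^n$ (some $\delta>0$) with $\gamma(0)=x$, $\lim_{t\to0^+}\frac{\gamma(t)-x}{\|\gamma(t)-x\|}=v$,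 and $A\cap\gamma((0,\eta])\ne\varnothing$ for every $\eta\in(0,\delta]$; $\Gamma_\gamma:=\gamma([0,\delta])$. Point-extended box dimension: for bounded $E$, $N_\varepsilon(E)$ is the minimal number of sets of diameter at most $\varepsilon$ covering $E$ and $\overline{\dim}_B(E):=\limsup_{\varepsilon\to0}\frac{\ln N_\varepsilon(E)}{\ln(1/\varepsilon)}$. For $x\in\overline E$, $\dim_{\mathrm{Pbox}}\{x\}_E:=\inf_{r>0}\overline{\dim}_B(E\cap B(x,r))$; it is $0$ if $x\notin\overline E$. Directional contribution: for $v\in\mathrm{Eff}_x(A)$, $\theta_x^A(v):=\sup_{\gamma\in\mathcal G_x^A(v)}\dim_{\mathrm{Pbox}}\{x\}_{A\cap\Gamma_\gamma}$; for $\xi\in\mathrm{Eff}_x^{\mathbb P}(A)$, $\theta_x^A(\xi):=\sup\{\theta_x^A(w):w\in\mathrm{Eff}_x(A),[w]=\xi\}$. Point-Cross dimension at $x\in\overline A$: $\dim_\times\{x\}_A:=\sup\sum_{i=1}^k\theta_x^A(\xi_i)$ over all $k\in\{0,\dots,n\}$ and all $\xi_1,\dots,\xi_k\in\mathrm{Eff}_x^{\mathbb P}(A)$ that are projectively (linearly) independent, i.e. nonzero representatives are linearly independent (empty family allowed, with sum $0$). *)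

theory Defs
  imports "HOL-Analysis.Analysis"
begin

definition tangent_cone :: "'a::euclidean_space \<Rightarrow> 'a set \<Rightarrow> 'a set" where
  "tangent_cone x A = {v. \<exists>X lam. (\<forall>k::nat. X k \<in> A) \<and> X \<longlonglongrightarrow> x \<and>
     (\<forall>k. lam k > (0::real)) \<and> decseq lam \<and> lam \<longlonglongrightarrow> 0 \<and>
     (\<lambda>k. (X k - x) /\<^sub>R lam k) \<longlonglongrightarrow> v}"

definition dim_Ptan :: "'a::euclidean_space \<Rightarrow> 'a set \<Rightarrow> nat" where
  "dim_Ptan x A = dim (span (tangent_cone x A))"

definition Eff :: "'a::euclidean_space \<Rightarrow> 'a set \<Rightarrow> 'a set" where
  "Eff x A = (if x \<in> closure A then tangent_cone x A \<inter> sphere 0 1 else {})"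

text \<open>A point of projective space is represented by the line through the origin that it
  stands for, so \<open>[v]\<close> is \<open>span {v}\<close> for nonzero \<open>v\<close>.\<close>

definition Eff_proj :: "'a::euclidean_space \<Rightarrow> 'a set \<Rightarrow> 'a set set" where
  "Eff_proj x A = (\<lambda>v. span {v}) ` Eff x A"

text \<open>A probe is a pair \<open>(\<gamma>, \<delta>)\<close>; only the values of \<open>\<gamma>\<close> on \<open>{0..\<delta>}\<close> matter.\<close>

definition probes :: "'a::euclidean_space \<Rightarrow> 'a set \<Rightarrow> 'a \<Rightarrow> ((real \<Rightarrow> 'a) \<times> real) set" where
  "probes x A v = {(\<gamma>, \<delta>). \<delta> > 0 \<and> inj_on \<gamma> {0..\<delta>} \<and> (\<exists>L. L-lipschitz_on {0..\<delta>} \<gamma>) \<and>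
     \<gamma> 0 = x \<and>
     ((\<lambda>t. (\<gamma> t - x) /\<^sub>R norm (\<gamma> t - x)) \<longlongrightarrow> v) (at_right 0) \<and>
     (\<forall>\<eta>\<in>{0<..\<delta>}. A \<inter> \<gamma> ` {0<..\<eta>} \<noteq> {})}"

text \<open>The condition \<open>bounded S\<close> is needed because \<^const>\<open>diameter\<close> is unspecified on
  unbounded sets.\<close>

definition covering_number :: "real \<Rightarrow> 'a::euclidean_space set \<Rightarrow> nat" where
  "covering_number \<epsilon> E = (LEAST N. \<exists>C. finite C \<and> card C = N \<and>
     (\<forall>S\<in>C. bounded S \<and> diameter S \<le> \<epsilon>) \<and> E \<subseteq> \<Union>C)"

text \<open>All dimensions below take values in \<^typ>\<open>ennreal\<close>, so that suprema and infima always
  exist and a supremum over the empty set is 0. The coercion from \<^typ>\<open>real\<close> truncates nothing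
  relevant: the quotient is nonnegative for \<open>0 < \<epsilon> < 1\<close>, as the covering number of a
  nonempty bounded set is at least 1 (and \<open>ln 0 = 0\<close>, so the empty set gets dimension 0).\<close>

definition upper_box_dim :: "'a::euclidean_space set \<Rightarrow> ennreal" where
  "upper_box_dim E =
     Limsup (at_right 0) (\<lambda>\<epsilon>. ennreal (ln (real (covering_number \<epsilon> E)) / ln (1 / \<epsilon>)))"

definition dim_Pbox :: "'a::euclidean_space \<Rightarrow> 'a set \<Rightarrow> ennreal" where
  "dim_Pbox x E =
     (if x \<in> closure E then INF r\<in>{0<..}. upper_box_dim (E \<inter> ball x r) else 0)"

definition theta :: "'a::euclidean_space \<Rightarrow> 'a set \<Rightarrow> 'a \<Rightarrow> ennreal" where
  "theta x A v = (SUP (\<gamma>, \<delta>)\<in>probes x A v. dim_Pbox x (A \<inter> \<gamma> ` {0..\<delta>}))"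

definition theta_proj :: "'a::euclidean_space \<Rightarrow> 'a set \<Rightarrow> 'a set \<Rightarrow> ennreal" where
  "theta_proj x A \<xi> = (SUP w\<in>{w \<in> Eff x A. span {w} = \<xi>}. theta x A w)"

text \<open>Linear independence of the family \<open>v 0, \<dots>, v (k - 1)\<close> is injectivity together with
  independence of the set of its values.\<close>

definition proj_independent :: "nat \<Rightarrow> (nat \<Rightarrow> 'a::euclidean_space set) \<Rightarrow> bool" where
  "proj_independent k \<xi> \<longleftrightarrow>
     (\<forall>v. (\<forall>i<k. v i \<in> \<xi> i \<and> v i \<noteq> 0) \<longrightarrow> inj_on v {..<k} \<and> independent (v ` {..<k}))"

definition dim_cross :: "'a::euclidean_space \<Rightarrow> 'a set \<Rightarrow> ennreal" where
  "dim_cross x A =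
     (SUP (k, \<xi>)\<in>{(k, \<xi>). k \<le> DIM('a) \<and> (\<forall>i<k. \<xi> i \<in> Eff_proj x A) \<and> proj_independent k \<xi>}.
        \<Sum>i<k. theta_proj x A (\<xi> i))"

end

theory Submission
  imports Defs
begin

text \<open>
  Upper bound: a Lipschitz curve has upper box dimension at most 1, so every directional
  contribution is at most 1 and the cross dimension is bounded by the dimension of the span of
  the tangent cone, which for \<open>A \<times> B\<close> lies in the product of the two tangent cones.

  Lower bound: directions of \<open>A\<close> and of \<open>B\<close>, embedded as \<open>(v, 0)\<close> and \<open>(0, w)\<close>, are jointly
  independent, so it suffices that embedding a direction does not decrease its contribution. If
  \<open>y \<in> B\<close>, a probe \<open>\<gamma>\<close> of \<open>A\<close> can be replaced by \<open>(\<gamma>, y)\<close>. If only \<open>y \<in> closure B\<close>, one uses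
  \<open>(\<gamma>, y + c)\<close> with \<open>c\<close> Lipschitz and \<open>c(t) = o(\<bar>\<gamma>(t) - x\<bar>)\<close>, such that \<open>y + c\<close> takes constant
  values in \<open>B\<close> on disjoint intervals \<open>[\<tau>\<^sub>n, \<sigma>\<^sub>n]\<close> shrinking to 0. These are chosen so that at one
  scale \<open>\<epsilon>\<^sub>n\<close> the piece of \<open>A\<close> on \<open>\<gamma>([\<tau>\<^sub>n, \<sigma>\<^sub>n])\<close> alone already needs about \<open>\<epsilon>\<^sub>n\<^sup>-\<^sup>s\<close> covering sets:
  the part of the curve before \<open>\<tau>\<^sub>n\<close> fits into a single set of diameter \<open>\<epsilon>\<^sub>n\<close>.
\<close>

section \<open>Covering numbers of bounded sets\<close>

lemma covering_number_le:
  assumes "finite C" "\<And>S. S \<in> C \<Longrightarrow> bounded S \<and> diameter S \<le> \<epsilon>" "E \<subseteq> \<Union>C"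
  shows "covering_number \<epsilon> E \<le> card C"
  unfolding covering_number_def by (rule Least_le) (use assms in blast)

text \<open>The \<open>LEAST\<close> is meaningful only once some finite cover exists. Total
  boundedness of the compact closure provides one by balls of radius \<open>\<epsilon>/2\<close>, so
  the minimum is attained.\<close>

lemma covering_number_cover:
  assumes "bounded E" "\<epsilon> > 0"
  obtains C where "finite C" "card C = covering_number \<epsilon> E"
    "\<And>S. S \<in> C \<Longrightarrow> bounded S \<and> diameter S \<le> \<epsilon>" "E \<subseteq> \<Union>C"
proof -
  have "compact (closure E)" using assms by (simp add: compact_closure)
  then obtain K where K: "finite K" "closure E \<subseteq> (\<Union>x\<in>K. ball x (\<epsilon>/2))"
    using assms(2) unfolding compact_eq_totally_bounded by (meson half_gt_zero)
  define C where "C = (\<lambda>x. ball x (\<epsilon>/2)) ` K"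
  have "\<exists>N. \<exists>C. finite C \<and> card C = N \<and>
     (\<forall>S\<in>C. bounded S \<and> diameter S \<le> \<epsilon>) \<and> E \<subseteq> \<Union>C"
    using K closure_subset[of E] assms(2)
    by (intro exI[of _ "card C"] exI[of _ C]) (auto simp: C_def)
  from LeastI_ex[OF this] that show ?thesis
    unfolding covering_number_def by blast
qed

text \<open>The images of the sets of an optimal cover keep diameter at most
  \<open>\<epsilon>\<close>. This is later applied to the projection of a product onto a
  factor.\<close>

lemma covering_number_image_le:
  assumes "bounded E" "\<epsilon> > 0" and p: "\<And>u v. dist (p u) (p v) \<le> dist u v"
  shows "covering_number \<epsilon> (p ` E) \<le> covering_number \<epsilon> E"
proof -
  obtain C where C: "finite C" "card C = covering_number \<epsilon> E"
    "\<And>S. S \<in> C \<Longrightarrow> bounded S \<and> diameter S \<le> \<epsilon>" "E \<subseteq> \<Union>C"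
    by (rule covering_number_cover[OF assms(1,2)]) blast
  have "bounded (p ` S) \<and> diameter (p ` S) \<le> \<epsilon>" if "S \<in> C" for S
  proof
    have d: "dist (p u) (p v) \<le> \<epsilon>" if "u \<in> S" "v \<in> S" for u v
      using p[of u v] C(3)[OF \<open>S \<in> C\<close>] diameter_bounded_bound[of S u v] that by force
    show "diameter (p ` S) \<le> \<epsilon>"
      by (rule diameter_le) (use assms(2) d in \<open>auto simp: dist_norm\<close>)
    show "bounded (p ` S)"
    proof (cases "S = {}")
      case False
      then obtain u where "u \<in> S" by blast
      then have "p ` S \<subseteq> cball (p u) \<epsilon>" using d by auto
      then show ?thesis by (rule bounded_subset[OF bounded_cball])
    qed simp
  qed
  moreover have "p ` E \<subseteq> \<Union>((`) p ` C)" using C(4) by blast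
  ultimately have "covering_number \<epsilon> (p ` E) \<le> card ((`) p ` C)"
    using C(1) by (intro covering_number_le) auto
  also have "\<dots> \<le> card C" using C(1) by (rule card_image_le)
  finally show ?thesis using C(2) by simp
qed

lemma covering_number_mono:
  assumes "bounded E" "\<epsilon> > 0" "F \<subseteq> E"
  shows "covering_number \<epsilon> F \<le> covering_number \<epsilon> E"
  by (rule covering_number_cover[OF assms(1,2)])
     (metis covering_number_le assms(3) order_trans)

text \<open>Allows the initial piece of a curve, close to \<open>x\<close>, to be discarded at the
  cost of one covering set.\<close>

lemma covering_number_insert_ball_le:
  assumes "bounded E" "\<epsilon> > 0" "F \<subseteq> cball x (\<epsilon>/2) \<union> E"
  shows "covering_number \<epsilon> F \<le> Suc (covering_number \<epsilon> E)"
proof -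
  obtain C where C: "finite C" "card C = covering_number \<epsilon> E"
    "\<And>S. S \<in> C \<Longrightarrow> bounded S \<and> diameter S \<le> \<epsilon>" "E \<subseteq> \<Union>C"
    by (rule covering_number_cover[OF assms(1,2)]) blast
  have "covering_number \<epsilon> F \<le> card (insert (cball x (\<epsilon>/2)) C)"
    using C assms by (intro covering_number_le) auto
  also have "\<dots> \<le> Suc (card C)" by (simp add: C(1) card_insert_if)
  finally show ?thesis using C(2) by simp
qed

lemma covering_number_pos:
  assumes "bounded E" "\<epsilon> > 0" "E \<noteq> {}"
  shows "covering_number \<epsilon> E > 0"
  by (rule covering_number_cover[OF assms(1,2)]) (use assms(3) in \<open>auto simp: card_gt_0_iff\<close>)

section \<open>Lipschitz arcs and the bound 1 for directional contributions\<close>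

lemma covering_number_lipschitz_arc_le:
  fixes \<gamma> :: "real \<Rightarrow> 'a::euclidean_space"
  assumes L: "L-lipschitz_on {0..\<delta>} \<gamma>" and \<delta>: "\<delta> > 0" and \<epsilon>: "\<epsilon> > 0"
    and E: "E \<subseteq> \<gamma> ` {0..\<delta>}"
  shows "real (covering_number \<epsilon> E) \<le> L * \<delta> / \<epsilon> + 2"
proof -
  have L0: "L \<ge> 0" using L by (rule lipschitz_on_nonneg)
  \<comment> \<open>Cutting \<open>{0..\<delta>}\<close> into \<open>n\<close> equal intervals gives
    images of diameter at most \<open>L * \<delta> / n \<le> \<epsilon>\<close>. The
    \<open>Suc\<close> keeps \<open>n\<close> positive even if \<open>L = 0\<close>.\<close>
  define n where "n = Suc (nat \<lceil>L * \<delta> / \<epsilon>\<rceil>)"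
  have n: "L * \<delta> / \<epsilon> \<le> real n" "real n \<le> L * \<delta> / \<epsilon> + 2" "n > 0"
    using L0 \<delta> \<epsilon> of_int_ceiling_le_add_one[of "L * \<delta> / \<epsilon>"] 
    by (auto simp: n_def intro: order_trans[OF le_of_int_ceiling]) linarith
  define C where "C = (\<lambda>k. \<gamma> ` {t \<in> {0..\<delta>}. real k * (\<delta>/n) \<le> t \<and> t \<le> real (Suc k) * (\<delta>/n)}) ` {..<n}"
  have "covering_number \<epsilon> E \<le> card C"
  proof (rule covering_number_le)
    show "finite C" by (simp add: C_def)
    show "bounded S \<and> diameter S \<le> \<epsilon>" if "S \<in> C" for S
    proof
      obtain k where S: "S = \<gamma> ` {t \<in> {0..\<delta>}. real k * (\<delta>/n) \<le> t \<and> t \<le> real (Suc k) * (\<delta>/n)}"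
        using \<open>S \<in> C\<close> unfolding C_def by blast
      have d: "dist (\<gamma> s) (\<gamma> t) \<le> \<epsilon>"
        if "s \<in> {t \<in> {0..\<delta>}. real k * (\<delta>/n) \<le> t \<and> t \<le> real (Suc k) * (\<delta>/n)}"
           "t \<in> {t \<in> {0..\<delta>}. real k * (\<delta>/n) \<le> t \<and> t \<le> real (Suc k) * (\<delta>/n)}" for s t
      proof -
        have "real (Suc k) * (\<delta>/n) = real k * (\<delta>/n) + \<delta>/n" by (simp add: algebra_simps add_divide_distrib)
        then have "dist s t \<le> \<delta>/n" using that by (auto simp: dist_real_def abs_le_iff)
        then have "L * dist s t \<le> L * (\<delta>/n)" using L0 by (rule mult_left_mono)
        also have "\<dots> \<le> \<epsilon>" using n(1,3) \<epsilon> by (simp add: field_simps)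
        finally show ?thesis using lipschitz_onD[OF L, of s t] that by auto
      qed
      show "diameter S \<le> \<epsilon>" unfolding S
        by (rule diameter_le) (use \<epsilon> d in \<open>auto simp: dist_norm\<close>)
      have "continuous_on {0..\<delta>} \<gamma>" using L by (rule lipschitz_on_continuous_on)
      then have "bounded (\<gamma> ` {0..\<delta>})"
        by (simp add: compact_continuous_image compact_imp_bounded)
      then show "bounded S" unfolding S by (rule bounded_subset) auto
    qed
    show "E \<subseteq> \<Union>C"
    proof
      fix z assume "z \<in> E"
      then obtain t where t: "t \<in> {0..\<delta>}" "z = \<gamma> t" using E by auto
      \<comment> \<open>The cap \<open>n - 1\<close> matters at \<open>t = \<delta>\<close>, where
        the floor is \<open>n\<close> but the last interval has index \<open>n - 1\<close>.\<close>
      define k where "k = min (n-1) (nat \<lfloor>t * n / \<delta>\<rfloor>)"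
      have k: "k < n" using n by (auto simp: k_def)
      have f: "real (nat \<lfloor>t * n / \<delta>\<rfloor>) \<le> t * n / \<delta>" "t * n / \<delta> < real (nat \<lfloor>t * n / \<delta>\<rfloor>) + 1"
        using t \<delta> by (auto simp: of_nat_nat)
      have k1: "real k \<le> t * n / \<delta>" using f by (auto simp: k_def)
      have k2: "t * n / \<delta> \<le> real (Suc k)"
      proof (cases "nat \<lfloor>t * n / \<delta>\<rfloor> \<le> n - 1")
        case True
        then have "k = nat \<lfloor>t * n / \<delta>\<rfloor>" by (simp add: k_def)
        then show ?thesis using f(2) by linarith
      next
        case False
        then have "Suc k = n" using n by (auto simp: k_def)
        then show ?thesis using t \<delta> by (simp add: field_simps)
      qed
      have "real k * (\<delta>/n) \<le> t" "t \<le> real (Suc k) * (\<delta>/n)"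
        using k1 k2 n(3) \<delta> by (simp_all add: field_simps)
      then show "z \<in> \<Union>C" using k t unfolding C_def by blast
    qed
  qed
  also have "card C \<le> n" unfolding C_def using card_image_le[of "{..<n}"] by force
  finally show ?thesis using n(2) by linarith
qed

lemma upper_box_dim_lipschitz_arc_le:
  fixes \<gamma> :: "real \<Rightarrow> 'a::euclidean_space"
  assumes L: "L-lipschitz_on {0..\<delta>} \<gamma>" and \<delta>: "\<delta> > 0" and E: "E \<subseteq> \<gamma> ` {0..\<delta>}"
  shows "upper_box_dim E \<le> 1"
proof -
  have L0: "L \<ge> 0" using L by (rule lipschitz_on_nonneg)
  \<comment> \<open>\<open>K\<close> absorbs the additive 2, since
    \<open>2 \<le> 2 / \<epsilon>\<close> for \<open>\<epsilon> < 1\<close>; its logarithm is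
    negligible against \<open>ln (1/\<epsilon>)\<close>.\<close>
  define K where "K = L * \<delta> + 2"
  have K: "K > 0" using L0 \<delta> by (simp add: K_def add_nonneg_pos)
  have "eventually (\<lambda>\<epsilon>. ennreal (ln (real (covering_number \<epsilon> E)) / ln (1 / \<epsilon>))
          \<le> ennreal (1 + max 0 (ln K) / ln (1/\<epsilon>))) (at_right 0)"
  proof (rule eventually_at_rightI[of 0 1])
    fix \<epsilon> :: real assume "\<epsilon> \<in> {0<..<1}"
    then have e: "0 < \<epsilon>" "\<epsilon> < 1" by auto
    have l: "ln (1/\<epsilon>) > 0" using e by simp
    let ?N = "real (covering_number \<epsilon> E)"
    have "?N \<le> L * \<delta> / \<epsilon> + 2" by (rule covering_number_lipschitz_arc_le[OF L \<delta> e(1) E])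
    also have "\<dots> \<le> K / \<epsilon>" using e by (simp add: K_def field_simps)
    finally have N: "?N \<le> K / \<epsilon>" .
    have "ln ?N \<le> ln (1/\<epsilon>) + max 0 (ln K)"
    proof (cases "?N = 0")
      case True then show ?thesis using l by simp
    next
      case False
      then have "ln ?N \<le> ln (K / \<epsilon>)" using N by (subst ln_le_cancel_iff) (use K e in auto)
      also have "\<dots> = ln (1/\<epsilon>) + ln K" using K e by (simp add: ln_div)
      finally show ?thesis by simp
    qed
    then have "ln ?N / ln (1/\<epsilon>) \<le> 1 + max 0 (ln K) / ln (1/\<epsilon>)"
      using l by (simp add: field_simps)
    then show "ennreal (ln ?N / ln (1 / \<epsilon>)) \<le> ennreal (1 + max 0 (ln K) / ln (1/\<epsilon>))"
      by (rule ennreal_leI)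
  qed simp
  then have "upper_box_dim E \<le> Limsup (at_right 0) (\<lambda>\<epsilon>. ennreal (1 + max 0 (ln K) / ln (1/\<epsilon>)))"
    unfolding upper_box_dim_def by (rule Limsup_mono)
  also have "\<dots> = ennreal (1 + 0)"
  proof (rule lim_imp_Limsup)
    have "filterlim (\<lambda>\<epsilon>::real. ln (1/\<epsilon>)) at_top (at_right 0)"
      by (rule filterlim_compose[OF ln_at_top])
         (use filterlim_inverse_at_top_right in \<open>simp add: inverse_eq_divide\<close>)
    then have "((\<lambda>\<epsilon>. max 0 (ln K) / ln (1/\<epsilon>)) \<longlongrightarrow> 0) (at_right 0)"
      by (rule real_tendsto_divide_at_top[OF tendsto_const])
    then show "((\<lambda>\<epsilon>. ennreal (1 + max 0 (ln K) / ln (1/\<epsilon>))) \<longlongrightarrow> ennreal (1 + 0)) (at_right 0)"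
      by (intro tendsto_ennrealI tendsto_add tendsto_const)
  qed simp
  finally show ?thesis by simp
qed

text \<open>What a probe sees of \<open>A\<close> lies on a Lipschitz arc, so already the radius 1
  term of the infimum is at most 1.\<close>

lemma theta_le_1: "theta x A v \<le> 1"
  unfolding theta_def
proof (rule SUP_least, clarify)
  fix \<gamma> \<delta> assume "(\<gamma>, \<delta>) \<in> probes x A v"
  then obtain L where *: "\<delta> > 0" "L-lipschitz_on {0..\<delta>} \<gamma>" by (auto simp: probes_def)
  have "(INF r\<in>{0<..}. upper_box_dim (A \<inter> \<gamma> ` {0..\<delta>} \<inter> ball x r))
      \<le> upper_box_dim (A \<inter> \<gamma> ` {0..\<delta>} \<inter> ball x 1)"
    by (rule INF_lower) simp
  also have "\<dots> \<le> 1" by (rule upper_box_dim_lipschitz_arc_le[OF *(2,1)]) auto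
  finally show "dim_Pbox x (A \<inter> \<gamma> ` {0..\<delta>}) \<le> 1" by (simp add: dim_Pbox_def)
qed

section \<open>Linear independence of indexed families\<close>

text \<open>The coefficient form on the right can be split coordinatewise, which is how independence
  in a product is reduced to the factors.\<close>

lemma independent_family_iff:
  fixes v :: "nat \<Rightarrow> 'a::real_vector"
  shows "inj_on v {..<k} \<and> independent (v ` {..<k}) \<longleftrightarrow>
    (\<forall>c. (\<Sum>i<k. c i *\<^sub>R v i) = 0 \<longrightarrow> (\<forall>i<k. c i = 0))" (is "?L \<longleftrightarrow> ?R")
proof
  assume L: ?L
  show ?R
  proof (intro allI impI)
    fix c i assume c: "(\<Sum>i<k. c i *\<^sub>R v i) = 0" and i: "i < k"
    define u where "u = c \<circ> the_inv_into {..<k} v"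
    have u: "u (v j) = c j" if "j < k" for j
      using L that by (simp add: u_def the_inv_into_f_f)
    have "(\<Sum>w\<in>v ` {..<k}. u w *\<^sub>R w) = (\<Sum>i<k. u (v i) *\<^sub>R v i)"
      using L by (simp add: sum.reindex)
    also have "\<dots> = 0" using c u by simp
    finally have "u (v i) = 0"
      using independentD[of "v ` {..<k}" "v ` {..<k}" u "v i"] L i by auto
    then show "c i = 0" using u i by simp
  qed
next
  assume R: ?R
  have inj: "inj_on v {..<k}"
  proof (rule inj_onI, rule ccontr)
    fix i j assume ij: "i \<in> {..<k}" "j \<in> {..<k}" "v i = v j" "i \<noteq> j"
    \<comment> \<open>A repeated vector would give the nontrivial relation
      \<open>v i - v j = 0\<close>.\<close>
    define c where "c = (\<lambda>l. if l = i then 1 else if l = j then -1 else (0::real))"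
    have "(\<Sum>l<k. c l *\<^sub>R v l) = (\<Sum>l<k. (if l = i then v i else 0) - (if l = j then v j else 0))"
      by (rule sum.cong) (use ij in \<open>auto simp: c_def\<close>)
    also have "\<dots> = 0" using ij by (simp add: sum_subtractf)
    finally have "c i = 0" using R ij by blast
    then show False by (simp add: c_def)
  qed
  moreover have "independent (v ` {..<k})"
    unfolding independent_explicit_finite_subsets
  proof (intro allI impI ballI)
    fix S u w assume S: "S \<subseteq> v ` {..<k}" and u: "(\<Sum>w\<in>S. u w *\<^sub>R w) = 0" and w: "w \<in> S"
    define c where "c i = (if v i \<in> S then u (v i) else 0)" for i
    have "(\<Sum>i<k. c i *\<^sub>R v i) = (\<Sum>w\<in>v ` {..<k}. (if w \<in> S then u w else 0) *\<^sub>R w)"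
      using inj by (simp add: sum.reindex c_def)
    also have "\<dots> = (\<Sum>w\<in>S. u w *\<^sub>R w)"
      using S by (intro sum.mono_neutral_cong_right) auto
    finally have "\<forall>i<k. c i = 0" using R u by auto
    then show "u w = 0" using S w by (force simp: c_def)
  qed
  ultimately show ?L by blast
qed

section \<open>Tangent cones and the upper bound\<close>

text \<open>Projecting the sequence works because one scale sequence \<open>lam\<close> serves both
  coordinates.\<close>

lemma tangent_cone_Times_subset:
  "tangent_cone (x, y) (A \<times> B) \<subseteq> tangent_cone x A \<times> tangent_cone y B"
proof
  fix p assume "p \<in> tangent_cone (x, y) (A \<times> B)"
  then obtain X lam where X: "\<And>k::nat. X k \<in> A \<times> B" "X \<longlonglongrightarrow> (x, y)" "\<And>k. lam k > (0::real)"
    "decseq lam" "lam \<longlonglongrightarrow> 0" "(\<lambda>k. (X k - (x, y)) /\<^sub>R lam k) \<longlonglongrightarrow> p"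
    unfolding tangent_cone_def by blast
  have "fst p \<in> tangent_cone x A"
    using X(1,3-5) tendsto_fst[OF X(2)] tendsto_fst[OF X(6)]
    unfolding tangent_cone_def
    by (intro CollectI exI[of _ "\<lambda>k. fst (X k)"] exI[of _ lam]) (auto simp: mem_Times_iff)
  moreover have "snd p \<in> tangent_cone y B"
    using X(1,3-5) tendsto_snd[OF X(2)] tendsto_snd[OF X(6)]
    unfolding tangent_cone_def
    by (intro CollectI exI[of _ "\<lambda>k. snd (X k)"] exI[of _ lam]) (auto simp: mem_Times_iff)
  ultimately show "p \<in> tangent_cone x A \<times> tangent_cone y B" by (simp add: mem_Times_iff)
qed

lemma dim_Ptan_Times_le: "dim_Ptan (x, y) (A \<times> B) \<le> dim_Ptan x A + dim_Ptan y B"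
proof -
  have "dim (tangent_cone (x, y) (A \<times> B)) \<le> dim (span (tangent_cone x A) \<times> span (tangent_cone y B))"
    using tangent_cone_Times_subset[of x y A B]
    by (intro dim_subset) (force intro: span_base)
  also have "\<dots> = dim (span (tangent_cone x A)) + dim (span (tangent_cone y B))"
    by (intro dim_Times subspace_span)
  finally show ?thesis by (simp add: dim_Ptan_def)
qed

text \<open>Unit representatives of \<open>k\<close> independent directions are \<open>k\<close>
  independent vectors of the tangent cone, so \<open>k\<close> is at most its dimension, and each
  direction contributes at most 1.\<close>

lemma dim_cross_le_dim_Ptan: "dim_cross x A \<le> of_nat (dim_Ptan x A)"
  unfolding dim_cross_def
proof (rule SUP_least, clarify)
  fix k :: nat and \<xi> assume \<xi>: "\<forall>i<k. \<xi> i \<in> Eff_proj x A" and ind: "proj_independent k \<xi>"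
  have "\<forall>i. \<exists>v. i < k \<longrightarrow> v \<in> Eff x A \<and> \<xi> i = span {v}" using \<xi> by (auto simp: Eff_proj_def)
  then obtain v where v: "\<And>i. i < k \<Longrightarrow> v i \<in> Eff x A \<and> \<xi> i = span {v i}" by metis
  have T: "v i \<in> tangent_cone x A \<and> v i \<noteq> 0" if "i < k" for i
    using v[OF that] by (auto simp: Eff_def split: if_splits)
  then have iv: "inj_on v {..<k} \<and> independent (v ` {..<k})"
    using ind v unfolding proj_independent_def by (simp add: span_base)
  then have "k = card (v ` {..<k})" by (simp add: card_image)
  also have "\<dots> \<le> dim (tangent_cone x A)"
    using iv T by (intro independent_card_le_dim) auto
  finally have k: "k \<le> dim_Ptan x A" by (simp add: dim_Ptan_def)
  have "(\<Sum>i<k. theta_proj x A (\<xi> i)) \<le> (\<Sum>i<k. 1)"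
    unfolding theta_proj_def by (intro sum_mono SUP_least theta_le_1)
  also have "\<dots> = of_nat k" by simp
  also have "\<dots> \<le> of_nat (dim_Ptan x A)" using k by (rule of_nat_mono)
  finally show "(\<Sum>i<k. theta_proj x A (\<xi> i)) \<le> of_nat (dim_Ptan x A)" .
qed

section \<open>Lipschitz paths with prescribed plateaus\<close>

text \<open>The weights \<open>(1/2) ^ Suc n\<close> sum to exactly 1, so no constant is lost. It
  serves for convergence, for the Lipschitz bound and for the smallness of the path below.\<close>

lemma norm_suminf_halves_le:
  fixes f :: "nat \<Rightarrow> 'a::banach"
  assumes "\<And>n. norm (f n) \<le> (1/2) ^ Suc n * K"
  shows "summable f" "norm (suminf f) \<le> K"
proof -
  have s: "(\<lambda>n. (1/2::real) ^ Suc n * K) sums (1 * K)"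
    by (intro sums_mult2 power_half_series)
  have n: "summable (\<lambda>n. norm (f n))"
    by (rule summable_comparison_test'[OF sums_summable[OF s], of 0]) (use assms in simp)
  then show "summable f" by (rule summable_norm_cancel)
  have "norm (suminf f) \<le> (\<Sum>n. norm (f n))" using n by (rule summable_norm)
  also have "\<dots> \<le> (\<Sum>n. (1/2) ^ Suc n * K)"
    by (rule suminf_le[OF assms n sums_summable[OF s]])
  finally show "norm (suminf f) \<le> K" using sums_unique[OF s] by simp
qed

text \<open>The factor \<open>(1/2) ^ Suc n\<close> in the bound on \<open>d n\<close> makes the series of bumps converge, the
  factor \<open>(1/2) ^ n\<close> makes its sum small compared with \<open>K\<close> near 0.\<close>

lemma stepped_lipschitz_path:
  fixes \<tau> \<sigma> \<kappa> :: "nat \<Rightarrow> real" and d :: "nat \<Rightarrow> 'a::banach"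
  assumes \<tau>: "\<And>n. 0 < \<tau> n" "\<And>n. \<tau> n \<le> \<sigma> n" "\<And>n. \<sigma> (Suc n) \<le> \<tau> n / 2"
    and d: "\<And>n. norm (d n) \<le> (1/2) ^ Suc n * ((1/2) ^ n * \<kappa> n)" "\<And>n. \<kappa> n \<le> \<tau> n / 2"
  obtains c where "1-lipschitz_on UNIV c" "c 0 = 0"
    "\<And>n t. \<tau> n \<le> t \<Longrightarrow> t \<le> \<sigma> n \<Longrightarrow> c t = d n"
    "\<And>N t K. (\<And>n. \<tau> n / 2 \<le> t \<Longrightarrow> \<kappa> n \<le> K) \<Longrightarrow> 0 \<le> K \<Longrightarrow> t \<le> \<tau> N / 2 \<Longrightarrow> norm (c t) \<le> (1/2) ^ N * K"
proof -
  \<comment> \<open>\<open>D n t\<close> is the distance of \<open>t\<close> from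
    \<open>{\<tau> n..\<sigma> n}\<close>. The bump \<open>\<phi> n\<close> is 1 on that interval
    and falls linearly to 0 at distance \<open>\<tau> n / 2\<close>, hence with slope
    \<open>2 / \<tau> n\<close>.\<close>
  define D where "D n t = max 0 (max (\<tau> n - t) (t - \<sigma> n))" for n t
  define \<phi> where "\<phi> n t = max 0 (1 - D n t / (\<tau> n / 2))" for n t
  define c where "c t = (\<Sum>n. \<phi> n t *\<^sub>R d n)" for t
  have D_ge: "0 \<le> D n t" "\<tau> n - t \<le> D n t" "t - \<sigma> n \<le> D n t" for n t
    by (simp_all add: D_def)
  have D_le: "D n t \<le> D n s + \<bar>t - s\<bar>" for n t s
  proof -
    have "0 \<le> D n s + \<bar>t - s\<bar>" "\<tau> n - t \<le> D n s + \<bar>t - s\<bar>" "t - \<sigma> n \<le> D n s + \<bar>t - s\<bar>"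
      using D_ge[where n=n and t=s] by linarith+
    then show ?thesis unfolding D_def[of n t] by simp
  qed
  have \<phi>01: "0 \<le> \<phi> n t" "\<phi> n t \<le> 1" for n t
    using \<tau>(1)[of n] D_ge(1)[of n t] by (auto simp: \<phi>_def)
  have \<phi>1: "\<phi> n t = 1" if "\<tau> n \<le> t" "t \<le> \<sigma> n" for n t
    using that by (simp add: \<phi>_def D_def)
  have \<phi>0: "\<phi> n t = 0" if "\<tau> n / 2 \<le> D n t" for n t
    using that \<tau>(1)[of n] by (auto simp: \<phi>_def)
  have \<phi>0l: "\<phi> n t = 0" if "t \<le> \<tau> n / 2" for n t
    by (rule \<phi>0) (use that D_ge(2)[of n t] in linarith)
  have \<phi>_lip: "\<bar>\<phi> n t - \<phi> n s\<bar> \<le> \<bar>t - s\<bar> / (\<tau> n / 2)" for n t s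
  proof -
    have "\<bar>\<phi> n t - \<phi> n s\<bar> \<le> \<bar>D n t / (\<tau> n / 2) - D n s / (\<tau> n / 2)\<bar>"
      unfolding \<phi>_def by linarith
    also have "\<dots> = \<bar>D n t - D n s\<bar> / (\<tau> n / 2)"
      using \<tau>(1)[of n] unfolding diff_divide_distrib[symmetric] abs_divide by simp
    also have "\<bar>D n t - D n s\<bar> \<le> \<bar>t - s\<bar>"
      using D_le[of n t s] D_le[of n s t] by linarith
    finally show ?thesis using \<tau>(1)[of n] by (simp add: divide_right_mono)
  qed
  have \<kappa>0: "0 \<le> \<kappa> n" for n
  proof (rule ccontr)
    assume "\<not> 0 \<le> \<kappa> n"
    then have "(1/2) ^ Suc n * ((1/2) ^ n * \<kappa> n) < 0" by (intro mult_pos_neg) auto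
    then show False using norm_ge_zero[of "d n"] d(1)[of n] by linarith
  qed
  have d': "norm (d n) \<le> (1/2) ^ Suc n * \<kappa> n" for n
  proof -
    have "(1/2) ^ n * \<kappa> n \<le> 1 * \<kappa> n"
      by (intro mult_right_mono power_le_one \<kappa>0) auto
    then have "(1/2) ^ Suc n * ((1/2) ^ n * \<kappa> n) \<le> (1/2) ^ Suc n * \<kappa> n"
      by (intro mult_left_mono) auto
    then show ?thesis using d(1)[of n] by linarith
  qed
  have \<tau>_dec: "decseq \<tau>"
    unfolding decseq_Suc_iff
  proof
    fix n show "\<tau> (Suc n) \<le> \<tau> n" using \<tau>(1)[of n] \<tau>(2)[of "Suc n"] \<tau>(3)[of n] by linarith
  qed
  have \<tau>\<sigma>: "\<sigma> j \<le> \<tau> i / 2" if "i < j" for i j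
  proof -
    obtain m where m: "j = Suc m" "i \<le> m" using \<open>i < j\<close> by (cases j) auto
    have "\<tau> m \<le> \<tau> i" using \<tau>_dec m by (simp add: decseqD)
    then show ?thesis using \<tau>(3)[of m] m by simp
  qed
  have summ: "summable (\<lambda>n. \<phi> n t *\<^sub>R d n)" for t
  proof (rule norm_suminf_halves_le)
    fix n
    have "\<kappa> n \<le> \<tau> 0" using d(2)[of n] \<tau>(1)[of n] decseqD[OF \<tau>_dec, of 0 n] by simp
    then have "norm (d n) \<le> (1/2) ^ Suc n * \<tau> 0"
      by (intro order_trans[OF d'] mult_left_mono) auto
    moreover have "norm (\<phi> n t *\<^sub>R d n) \<le> 1 * norm (d n)"
      using \<phi>01[of n t] by (simp add: mult_left_le_one_le)
    ultimately show "norm (\<phi> n t *\<^sub>R d n) \<le> (1/2) ^ Suc n * \<tau> 0" by simp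
  qed
  show thesis
  proof
    show "1-lipschitz_on UNIV c"
    proof (rule lipschitz_onI)
      fix t s :: real
      have "dist (c t) (c s) = norm (\<Sum>n. \<phi> n t *\<^sub>R d n - \<phi> n s *\<^sub>R d n)"
        unfolding c_def dist_norm by (subst suminf_diff[OF summ summ, symmetric]) simp
      also have "\<dots> \<le> \<bar>t - s\<bar>"
      proof (rule norm_suminf_halves_le)
        fix n
        have "norm (\<phi> n t *\<^sub>R d n - \<phi> n s *\<^sub>R d n) = \<bar>\<phi> n t - \<phi> n s\<bar> * norm (d n)"
          by (simp add: scaleR_left_diff_distrib[symmetric])
        \<comment> \<open>The height \<open>\<kappa> n \<le> \<tau> n / 2\<close> cancels the slope
          of the bump, leaving only the weight.\<close>
        also have "\<dots> \<le> (\<bar>t - s\<bar> / (\<tau> n / 2)) * ((1/2) ^ Suc n * (\<tau> n / 2))"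
          using \<tau>(1)[of n] d(2)[of n]
          by (intro mult_mono \<phi>_lip order_trans[OF d'] mult_left_mono) auto
        also have "\<dots> = (1/2) ^ Suc n * \<bar>t - s\<bar>" using \<tau>(1)[of n] by simp
        finally show "norm (\<phi> n t *\<^sub>R d n - \<phi> n s *\<^sub>R d n) \<le> (1/2) ^ Suc n * \<bar>t - s\<bar>" .
      qed
      finally show "dist (c t) (c s) \<le> 1 * dist t s" by (simp add: dist_real_def)
    qed simp
    show "c 0 = 0" using \<phi>0l[of 0] \<tau>(1) by (simp add: c_def less_imp_le)
    show "c t = d n" if t: "\<tau> n \<le> t" "t \<le> \<sigma> n" for n t
    proof -
      \<comment> \<open>On the \<open>n\<close>-th interval no other bump is active: an earlier one
        vanishes up to \<open>\<tau> m / 2 \<ge> \<sigma> n\<close>, and a later one has died out,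
        since \<open>t\<close> exceeds \<open>\<sigma> m\<close> by at least
        \<open>\<tau> n / 2 \<ge> \<tau> m / 2\<close>.\<close>
      have "\<phi> m t = 0" if "m \<noteq> n" for m
      proof (rule \<phi>0)
        show "\<tau> m / 2 \<le> D m t"
        proof (cases "m < n")
          case True
          then show ?thesis using \<tau>\<sigma>[of m n] t D_ge(2)[of m t] by linarith
        next
          case False
          then have "n < m" using that by simp
          then have "\<tau> m \<le> \<tau> n" "\<sigma> m \<le> \<tau> n / 2"
            using \<tau>\<sigma>[of n m] decseqD[OF \<tau>_dec, of n m] by auto
          then show ?thesis using t D_ge(3)[of t m] by linarith
        qed
      qed
      then have "c t = (\<Sum>m\<in>{n}. \<phi> m t *\<^sub>R d m)"
        unfolding c_def by (intro suminf_finite) auto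
      then show ?thesis using \<phi>1[OF t] by simp
    qed
    show "norm (c t) \<le> (1/2) ^ N * K"
      if K: "\<And>n. \<tau> n / 2 \<le> t \<Longrightarrow> \<kappa> n \<le> K" "0 \<le> K" and t: "t \<le> \<tau> N / 2" for N t K
      unfolding c_def
    proof (rule norm_suminf_halves_le)
      fix n
      show "norm (\<phi> n t *\<^sub>R d n) \<le> (1/2) ^ Suc n * ((1/2) ^ N * K)"
      proof (cases "\<phi> n t = 0")
        case True then show ?thesis using K(2) by simp
      next
        case False
        then have nt: "\<tau> n / 2 < t" using \<phi>0l[of t n] by force
        \<comment> \<open>Only late bumps are active near 0, which turns the factor
          \<open>(1/2) ^ n\<close> into a uniform gain \<open>(1/2) ^ N\<close>.\<close>
        have "N \<le> n" using nt t decseqD[OF \<tau>_dec, of n N] by (cases "N \<le> n") auto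
        have "norm (\<phi> n t *\<^sub>R d n) \<le> 1 * norm (d n)"
          using \<phi>01[of n t] by (simp add: mult_left_le_one_le)
        also have "\<dots> \<le> (1/2) ^ Suc n * ((1/2) ^ n * \<kappa> n)" using d(1) by simp
        also have "\<dots> \<le> (1/2) ^ Suc n * ((1/2) ^ N * K)"
          using K(1)[of n] nt \<kappa>0 \<open>N \<le> n\<close>
          by (intro mult_left_mono mult_mono power_decreasing) auto
        finally show ?thesis .
      qed
    qed
  qed
qed

section \<open>Localizing box dimension along a probe\<close>

text \<open>The distance to \<open>x\<close> attains its minimum on a compact parameter interval,
  and injectivity keeps it away from 0. Thus small balls around \<open>x\<close> see only small
  parameters.\<close>

lemma probe_dist_lower_bound:
  assumes "(\<gamma>, \<delta>) \<in> probes x A v" "0 < \<eta>" "\<eta> \<le> \<delta>"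
  obtains r where "r > 0" "\<And>t. \<eta> \<le> t \<Longrightarrow> t \<le> \<delta> \<Longrightarrow> r \<le> norm (\<gamma> t - x)"
proof -
  obtain L where p: "\<delta> > 0" "inj_on \<gamma> {0..\<delta>}" "L-lipschitz_on {0..\<delta>} \<gamma>" "\<gamma> 0 = x"
    using assms(1) by (auto simp: probes_def)
  have "continuous_on {\<eta>..\<delta>} \<gamma>"
    using lipschitz_on_continuous_on[OF p(3)] by (rule continuous_on_subset) (use assms(2) in auto)
  then have "continuous_on {\<eta>..\<delta>} (\<lambda>t. norm (\<gamma> t - x))" by (intro continuous_intros)
  then obtain u where u: "u \<in> {\<eta>..\<delta>}" "\<And>t. t \<in> {\<eta>..\<delta>} \<Longrightarrow> norm (\<gamma> u - x) \<le> norm (\<gamma> t - x)"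
    using continuous_attains_inf[of "{\<eta>..\<delta>}" "\<lambda>t. norm (\<gamma> t - x)"] assms(3) by auto
  have "\<gamma> u \<noteq> \<gamma> 0" using inj_onD[OF p(2), of u 0] u(1) assms(2) by auto
  then show thesis using u(2) p(4) by (intro that[of "norm (\<gamma> u - x)"]) auto
qed

text \<open>A small ball around \<open>x\<close> sees only parameters below \<open>\<eta>\<close>
  and still needs more than \<open>\<epsilon>\<close> to the power \<open>-s'\<close> sets for some
  \<open>s' > s\<close> and a small \<open>\<epsilon>\<close>. With \<open>\<tau>\<close> chosen
  after \<open>\<epsilon>\<close>, the part before \<open>\<tau>\<close> costs one set, and the
  slack \<open>s' - s\<close> pays for it.\<close>

lemma probe_chunk:
  assumes p: "(\<gamma>, \<delta>) \<in> probes x A v"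
    and s: "0 \<le> s" "ennreal s < dim_Pbox x (A \<inter> \<gamma> ` {0..\<delta>})"
    and \<eta>: "0 < \<eta>" "\<eta> \<le> \<delta>"
  obtains \<tau> \<epsilon> where "0 < \<tau>" "\<tau> \<le> \<eta>" "0 < \<epsilon>" "\<epsilon> < \<eta>" "A \<inter> \<gamma> ` {\<tau>..\<eta>} \<noteq> {}"
    "ennreal s \<le> ennreal (ln (real (covering_number \<epsilon> (A \<inter> \<gamma> ` {\<tau>..\<eta>}))) / ln (1 / \<epsilon>))"
proof -
  obtain L where L: "L-lipschitz_on {0..\<delta>} \<gamma>" using p by (auto simp: probes_def)
  have L0: "L \<ge> 0" using L by (rule lipschitz_on_nonneg)
  have x: "\<gamma> 0 = x" using p by (auto simp: probes_def)
  have bd: "bounded (\<gamma> ` {0..\<delta>})"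
    using lipschitz_on_continuous_on[OF L] by (simp add: compact_continuous_image compact_imp_bounded)
  obtain s'' where s'': "ennreal s < s''" "s'' < dim_Pbox x (A \<inter> \<gamma> ` {0..\<delta>})" using dense[OF s(2)] by blast
  then have "s'' < top" by (meson order.strict_trans2 top_greatest)
  then obtain s' where s': "s'' = ennreal s'" "0 \<le> s'" by (cases s'') auto
  have ss': "s < s'" using s''(1) s(1) s' by (simp add: ennreal_less_iff)
  obtain r where r: "r > 0" "\<And>t. \<eta> \<le> t \<Longrightarrow> t \<le> \<delta> \<Longrightarrow> r \<le> norm (\<gamma> t - x)"
    by (rule probe_dist_lower_bound[OF p \<eta>]) blast
  let ?E = "A \<inter> \<gamma> ` {0..\<delta>} \<inter> ball x r"
  let ?q = "\<lambda>\<epsilon>. ln (real (covering_number \<epsilon> ?E)) / ln (1 / \<epsilon>)"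
  have "dim_Pbox x (A \<inter> \<gamma> ` {0..\<delta>}) \<le> upper_box_dim ?E"
    unfolding dim_Pbox_def using r(1) by (auto intro: INF_lower)
  then have s''_lt: "s'' < upper_box_dim ?E" using s'' by simp
  have "\<not> eventually (\<lambda>\<epsilon>. ennreal (?q \<epsilon>) \<le> ennreal s') (at_right 0)"
  proof
    assume "eventually (\<lambda>\<epsilon>. ennreal (?q \<epsilon>) \<le> ennreal s') (at_right 0)"
    then have "upper_box_dim ?E \<le> ennreal s'"
      unfolding upper_box_dim_def by (rule Limsup_bounded)
    then show False using s''_lt s'(1) by simp
  qed
  \<comment> \<open>The three bounds yield \<open>\<epsilon> < \<eta>\<close>, positivity of
    \<open>ln (1/\<epsilon>)\<close>, and
    \<open>ln 2 \<le> (s' - s) * ln (1/\<epsilon>)\<close>.\<close>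
  moreover define \<epsilon>0 where "\<epsilon>0 = min \<eta> (min (1/2) (exp (- (ln 2 / (s' - s)))))"
  have \<epsilon>0: "\<epsilon>0 > 0" using \<eta> by (simp add: \<epsilon>0_def)
  ultimately obtain \<epsilon> where \<epsilon>: "0 < \<epsilon>" "\<epsilon> < \<epsilon>0" "\<not> ennreal (?q \<epsilon>) \<le> ennreal s'"
    unfolding eventually_at_right_field by blast
  have q: "s' < ?q \<epsilon>" using \<epsilon>(3) by (meson ennreal_leI not_le)
  have \<epsilon>': "\<epsilon> < \<eta>" "\<epsilon> < 1" "\<epsilon> < exp (- (ln 2 / (s' - s)))" using \<epsilon>(2) by (auto simp: \<epsilon>0_def)
  have l: "ln (1/\<epsilon>) > 0" using \<epsilon> \<epsilon>' by simp
  have "ln \<epsilon> < - (ln 2 / (s' - s))"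
    using \<epsilon>'(3) \<epsilon>(1) by (metis exp_less_cancel_iff exp_ln)
  then have l2: "ln 2 \<le> (s' - s) * ln (1/\<epsilon>)"
    using \<epsilon>(1) ss' by (simp add: ln_div field_simps)
  have "A \<inter> \<gamma> ` {0<..\<eta>} \<noteq> {}" using p \<eta> by (auto simp: probes_def)
  then obtain t0 where t0: "0 < t0" "t0 \<le> \<eta>" "\<gamma> t0 \<in> A" by auto
  \<comment> \<open>\<open>t0\<close> keeps a point of \<open>A\<close> in the chunk; the other
    bound puts \<open>\<gamma>\<close> before \<open>\<tau>\<close> inside the ball of radius
    \<open>\<epsilon>/2\<close>. Dividing by \<open>L + 1\<close> allows for
    \<open>L = 0\<close>.\<close>
  define \<tau> where "\<tau> = min t0 (\<epsilon> / 2 / (L + 1))"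
  have \<tau>: "0 < \<tau>" "\<tau> \<le> \<eta>" using t0 \<epsilon>(1) L0 by (auto simp: \<tau>_def)
  let ?F = "A \<inter> \<gamma> ` {\<tau>..\<eta>}"
  have F: "?F \<noteq> {}" using t0 by (auto simp: \<tau>_def)
  have bF: "bounded ?F" using \<tau> \<eta> by (intro bounded_subset[OF bd]) auto
  have "?E \<subseteq> cball x (\<epsilon>/2) \<union> ?F"
  proof
    fix z assume z: "z \<in> ?E"
    then obtain t where t: "z = \<gamma> t" "0 \<le> t" "t \<le> \<delta>" by auto
    have "t < \<eta>"
    proof (rule ccontr)
      assume "\<not> t < \<eta>"
      then show False using r(2)[of t] t z by (auto simp: dist_norm norm_minus_commute)
    qed
    show "z \<in> cball x (\<epsilon>/2) \<union> ?F"
    proof (cases "\<tau> \<le> t")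
      case True then show ?thesis using \<open>t < \<eta>\<close> t z by auto
    next
      case False
      have "dist x z \<le> L * dist 0 t" using lipschitz_onD[OF L, of 0 t] t x \<eta> by auto
      also have "\<dots> \<le> (L + 1) * \<tau>" using False t L0 by (intro mult_mono) auto
      also have "\<dots> \<le> (L + 1) * (\<epsilon> / 2 / (L + 1))" using L0 by (intro mult_left_mono) (auto simp: \<tau>_def)
      also have "\<dots> = \<epsilon> / 2" using L0 by (simp add: field_simps)
      finally show ?thesis by simp
    qed
  qed
  then have N: "covering_number \<epsilon> ?E \<le> Suc (covering_number \<epsilon> ?F)"
    by (rule covering_number_insert_ball_le[OF bF \<epsilon>(1)])
  have F1: "covering_number \<epsilon> ?F \<ge> 1" using covering_number_pos[OF bF \<epsilon>(1) F] by simp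
  have E1: "real (covering_number \<epsilon> ?E) > 0"
    using q s'(2) by (cases "covering_number \<epsilon> ?E = 0") auto
  have "s' * ln (1/\<epsilon>) \<le> ln (real (covering_number \<epsilon> ?E))" using q l by (simp add: field_simps)
  \<comment> \<open>As the chunk is nonempty, its covering number \<open>N\<close> is at least 1 and
    \<open>Suc N \<le> 2 * N\<close>.\<close>
  also have "\<dots> \<le> ln (2 * real (covering_number \<epsilon> ?F))"
    by (subst ln_le_cancel_iff) (use N F1 E1 in auto)
  also have "\<dots> = ln 2 + ln (real (covering_number \<epsilon> ?F))" using F1 by (simp add: ln_mult)
  finally have "s * ln (1/\<epsilon>) \<le> ln (real (covering_number \<epsilon> ?F))"
    using l2 by (simp add: algebra_simps)
  then have "s \<le> ln (real (covering_number \<epsilon> ?F)) / ln (1/\<epsilon>)" using l by (simp add: field_simps)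
  then show thesis by (intro that[of \<tau> \<epsilon>] \<tau> \<epsilon> \<epsilon>' F ennreal_leI)
qed

text \<open>A limsup only needs the bound at arbitrarily small scales, and the scales may depend on
  the radius.\<close>

lemma dim_Pbox_ge:
  assumes "x \<in> closure E"
    and "\<And>r b. 0 < r \<Longrightarrow> 0 < b \<Longrightarrow> \<exists>\<epsilon>. 0 < \<epsilon> \<and> \<epsilon> < b \<and>
      s \<le> ennreal (ln (real (covering_number \<epsilon> (E \<inter> ball x r))) / ln (1 / \<epsilon>))"
  shows "s \<le> dim_Pbox x E"
proof -
  have "s \<le> upper_box_dim (E \<inter> ball x r)" if r: "r > 0" for r
    unfolding upper_box_dim_def Limsup_def
  proof (rule INF_greatest)
    fix P :: "real \<Rightarrow> bool" assume "P \<in> {P. eventually P (at_right 0)}"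
    then obtain b where b: "b > 0" "\<And>e. 0 < e \<Longrightarrow> e < b \<Longrightarrow> P e"
      unfolding eventually_at_right_field by auto
    obtain \<epsilon> where e: "0 < \<epsilon>" "\<epsilon> < b"
      "s \<le> ennreal (ln (real (covering_number \<epsilon> (E \<inter> ball x r))) / ln (1 / \<epsilon>))"
      using assms(2)[OF r b(1)] by blast
    show "s \<le> (SUP \<epsilon>\<in>Collect P. ennreal (ln (real (covering_number \<epsilon> (E \<inter> ball x r))) / ln (1 / \<epsilon>)))"
      by (rule SUP_upper2[of \<epsilon>]) (use b e in auto)
  qed
  then show ?thesis using assms(1) by (auto simp: dim_Pbox_def intro: INF_greatest)
qed

text \<open>Divided by \<open>norm (f t)\<close>, the sum still tends to \<open>v\<close>. As a
  limit of unit vectors \<open>v\<close> has norm 1, so normalizing is continuous there.\<close>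

lemma tendsto_direction_add:
  fixes f g :: "'t \<Rightarrow> 'a::real_normed_vector"
  assumes f: "((\<lambda>t. f t /\<^sub>R norm (f t)) \<longlongrightarrow> v) F" and g: "((\<lambda>t. g t /\<^sub>R norm (f t)) \<longlongrightarrow> 0) F"
    and ne: "eventually (\<lambda>t. f t \<noteq> 0) F" and F: "F \<noteq> bot"
  shows "((\<lambda>t. (f t + g t) /\<^sub>R norm (f t + g t)) \<longlongrightarrow> v) F"
proof -
  have "eventually (\<lambda>t. norm (f t /\<^sub>R norm (f t)) = 1) F"
    using ne by eventually_elim simp
  then have "((\<lambda>t. norm (f t /\<^sub>R norm (f t))) \<longlongrightarrow> 1) F" by (rule tendsto_eventually)
  then have v: "norm v = 1" using tendsto_unique[OF F tendsto_norm[OF f]] by simp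
  let ?h = "\<lambda>t. f t /\<^sub>R norm (f t) + g t /\<^sub>R norm (f t)"
  have h: "(?h \<longlongrightarrow> v) F" using tendsto_add[OF f g] by simp
  have "((\<lambda>t. ?h t /\<^sub>R norm (?h t)) \<longlongrightarrow> v /\<^sub>R norm v) F"
    by (intro tendsto_intros h) (use v in auto)
  moreover have "eventually (\<lambda>t. ?h t /\<^sub>R norm (?h t) = (f t + g t) /\<^sub>R norm (f t + g t)) F"
    using ne
  proof eventually_elim
    case (elim t)
    have "?h t = (f t + g t) /\<^sub>R norm (f t)" by (simp add: scaleR_right_distrib)
    then show ?case using elim by simp
  qed
  ultimately show ?thesis using v by (simp add: tendsto_cong)
qed

section \<open>Embedding a factor into a sum\<close>

text \<open>Used for the two coordinate embeddings of a product, in either order, with \<open>p\<close> the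
  corresponding projection.\<close>

locale isometric_summand =
  fixes i :: "'a::euclidean_space \<Rightarrow> 'c::euclidean_space"
    and j :: "'b::euclidean_space \<Rightarrow> 'c" and p :: "'c \<Rightarrow> 'a"
  assumes lin_i: "linear i" and lin_j: "linear j" and lin_p: "linear p"
    and norm_i: "norm (i u) = norm u" and norm_j: "norm (j w) = norm w"
    and norm_p: "norm (p z) \<le> norm z" and p_add: "p (i u + j w) = u"
begin

definition sumset :: "'a set \<Rightarrow> 'b set \<Rightarrow> 'c set" where
  "sumset A B = (\<lambda>(a, b). i a + j b) ` (A \<times> B)"

lemma sumset_diff: "(i a + j b) - (i x + j y) = i (a - x) + j (b - y)"
  by (simp add: linear_diff[OF lin_i] linear_diff[OF lin_j])

lemma dist_p_le: "dist (p u) (p v) \<le> dist u v"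
  using norm_p[of "u - v"] by (simp add: dist_norm linear_diff[OF lin_p])

lemma tendsto_i: "(f \<longlongrightarrow> u) F \<Longrightarrow> ((\<lambda>t. i (f t)) \<longlongrightarrow> i u) F"
  by (rule linear_continuous_at[THEN isCont_tendsto_compose])
     (use lin_i in \<open>simp_all add: linear_conv_bounded_linear\<close>)

lemma tendsto_j: "(f \<longlongrightarrow> u) F \<Longrightarrow> ((\<lambda>t. j (f t)) \<longlongrightarrow> j u) F"
  by (rule linear_continuous_at[THEN isCont_tendsto_compose])
     (use lin_j in \<open>simp_all add: linear_conv_bounded_linear\<close>)

lemma tangent_cone_sumset:
  assumes v: "v \<in> tangent_cone x A" and y: "y \<in> closure B"
  shows "i v \<in> tangent_cone (i x + j y) (sumset A B)"
proof -
  obtain X lam where X: "\<And>k::nat. X k \<in> A" "X \<longlonglongrightarrow> x" "\<And>k. lam k > (0::real)"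
    "decseq lam" "lam \<longlonglongrightarrow> 0" "(\<lambda>k. (X k - x) /\<^sub>R lam k) \<longlonglongrightarrow> v"
    using v unfolding tangent_cone_def by blast
  \<comment> \<open>Approximating \<open>y\<close> faster than \<open>lam k\<close> makes the second
    difference quotient vanish in the limit, so the direction stays \<open>i v\<close> with the same
    scales.\<close>
  have "\<forall>k. \<exists>b\<in>B. dist b y < lam k * (1 / real (Suc k))"
    using y X(3) by (auto simp: closure_approachable)
  then obtain Y where Y: "\<And>k. Y k \<in> B" "\<And>k. dist (Y k) y < lam k * (1 / real (Suc k))" by metis
  have Y0: "(\<lambda>k. (Y k - y) /\<^sub>R lam k) \<longlonglongrightarrow> 0"
  proof (rule Lim_null_comparison)
    show "eventually (\<lambda>k. norm ((Y k - y) /\<^sub>R lam k) \<le> 1 / real (Suc k)) sequentially"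
    proof (rule always_eventually, rule allI)
      fix k
      have "norm ((Y k - y) /\<^sub>R lam k) = dist (Y k) y / lam k"
        using X(3)[of k] by (simp add: dist_norm divide_inverse mult.commute)
      also have "\<dots> < 1 / real (Suc k)"
        using X(3)[of k] Y(2)[of k] by (simp only: pos_divide_less_eq mult.commute)
      finally show "norm ((Y k - y) /\<^sub>R lam k) \<le> 1 / real (Suc k)" by simp
    qed
    show "(\<lambda>k. 1 / real (Suc k)) \<longlonglongrightarrow> 0" using lim_inverse_n' by (rule LIMSEQ_Suc)
  qed
  have "(\<lambda>k. lam k *\<^sub>R ((Y k - y) /\<^sub>R lam k)) \<longlonglongrightarrow> 0 *\<^sub>R 0" by (intro tendsto_scaleR X(5) Y0)
  moreover have "lam k *\<^sub>R ((Y k - y) /\<^sub>R lam k) = Y k - y" for k using X(3)[of k] by simp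
  ultimately have "Y \<longlonglongrightarrow> y" by (simp add: LIM_zero_iff)
  then have "(\<lambda>k. i (X k) + j (Y k)) \<longlonglongrightarrow> i x + j y"
    by (intro tendsto_add tendsto_i tendsto_j X(2))
  moreover have "(\<lambda>k. i ((X k - x) /\<^sub>R lam k) + j ((Y k - y) /\<^sub>R lam k)) \<longlonglongrightarrow> i v + j 0"
    by (intro tendsto_add tendsto_i tendsto_j X(6) Y0)
  then have "(\<lambda>k. (i (X k) + j (Y k) - (i x + j y)) /\<^sub>R lam k) \<longlonglongrightarrow> i v"
    by (simp add: sumset_diff linear_scale[OF lin_i] linear_scale[OF lin_j] linear_0[OF lin_j]
        scaleR_right_distrib)
  moreover have "i (X k) + j (Y k) \<in> sumset A B" for k
    using X(1) Y(1) by (force simp: sumset_def)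
  ultimately show ?thesis
    unfolding tangent_cone_def using X(3-5)
    by (intro CollectI exI[of _ "\<lambda>k. i (X k) + j (Y k)"] exI[of _ lam]) auto
qed

lemma closure_sumset:
  assumes "x \<in> closure A" "y \<in> closure B"
  shows "i x + j y \<in> closure (sumset A B)"
proof -
  obtain X Y where "\<And>n. X n \<in> A" "X \<longlonglongrightarrow> x" "\<And>n. Y n \<in> B" "Y \<longlonglongrightarrow> y"
    using assms unfolding closure_sequential by blast
  then show ?thesis
    unfolding closure_sequential
    by (intro exI[of _ "\<lambda>n. i (X n) + j (Y n)"])
       (auto intro!: tendsto_add tendsto_i tendsto_j simp: sumset_def)
qed

lemma Eff_sumset:
  assumes "v \<in> Eff x A" "y \<in> closure B"
  shows "i v \<in> Eff (i x + j y) (sumset A B)"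
  using assms closure_sumset[of x A y B] tangent_cone_sumset[of v x A y B]
  by (auto simp: Eff_def norm_i split: if_splits)

lemma span_i: "span {i v} = i ` span {v}"
  using linear_span_image[OF lin_i, of "{v}"] by simp

text \<open>Each \<open>s\<close> below the dimension along a probe of \<open>A\<close> is matched
  by a probe of the sumset built for that \<open>s\<close>. The construction treats \<open>y\<close>
  in \<open>B\<close> and \<open>y\<close> merely in its closure uniformly.\<close>

lemma theta_sumset_ge:
  assumes y: "y \<in> closure B"
  shows "theta x A v \<le> theta (i x + j y) (sumset A B) (i v)"
  unfolding theta_def[of x]
proof (rule SUP_least, clarify, rule dense_le)
  fix \<gamma> \<delta> s
  assume pr: "(\<gamma>, \<delta>) \<in> probes x A v" and "s < dim_Pbox x (A \<inter> \<gamma> ` {0..\<delta>})"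
  then obtain s' where s: "s = ennreal s'" "0 \<le> s'" "ennreal s' < dim_Pbox x (A \<inter> \<gamma> ` {0..\<delta>})"
    by (cases s) auto
  from pr obtain L where \<gamma>: "\<delta> > 0" "inj_on \<gamma> {0..\<delta>}" "L-lipschitz_on {0..\<delta>} \<gamma>" "\<gamma> 0 = x"
    "((\<lambda>t. (\<gamma> t - x) /\<^sub>R norm (\<gamma> t - x)) \<longlongrightarrow> v) (at_right 0)"
    by (auto simp: probes_def)
  have L0: "L \<ge> 0" using \<gamma>(3) by (rule lipschitz_on_nonneg)
  let ?Q = "\<lambda>\<eta> \<tau> \<epsilon>. 0 < \<tau> \<and> \<tau> \<le> \<eta> \<and> 0 < \<epsilon> \<and> \<epsilon> < \<eta> \<and> A \<inter> \<gamma> ` {\<tau>..\<eta>} \<noteq> {} \<and>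
    s \<le> ennreal (ln (real (covering_number \<epsilon> (A \<inter> \<gamma> ` {\<tau>..\<eta>}))) / ln (1 / \<epsilon>))"
  have "\<exists>\<tau> \<epsilon>. 0 < \<eta> \<and> \<eta> \<le> \<delta> \<longrightarrow> ?Q \<eta> \<tau> \<epsilon>" for \<eta>
  proof (cases "0 < \<eta> \<and> \<eta> \<le> \<delta>")
    case True
    then have "0 < \<eta>" "\<eta> \<le> \<delta>" by auto
    from probe_chunk[OF pr s(2,3) this] show ?thesis unfolding s(1) by metis
  qed auto
  then obtain T e where Te: "\<And>\<eta>. 0 < \<eta> \<Longrightarrow> \<eta> \<le> \<delta> \<Longrightarrow> ?Q \<eta> (T \<eta>) (e \<eta>)" by metis
  \<comment> \<open>Each interval ends at half the start of the previous one. This leaves room for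
    the bumps to die out and forces \<open>\<sigma> n\<close> to 0.\<close>
  define \<sigma> where "\<sigma> n = ((\<lambda>\<eta>. T \<eta> / 2) ^^ n) \<delta>" for n
  define \<tau> where "\<tau> n = T (\<sigma> n)" for n
  define \<epsilon> where "\<epsilon> n = e (\<sigma> n)" for n
  have \<sigma>_Suc: "\<sigma> (Suc n) = \<tau> n / 2" for n by (simp add: \<sigma>_def \<tau>_def)
  have \<sigma>: "0 < \<sigma> n \<and> \<sigma> n \<le> \<delta> * (1/2) ^ n \<and> \<sigma> n \<le> \<delta>" for n
  proof (induction n)
    case 0 then show ?case using \<gamma>(1) by (simp add: \<sigma>_def)
  next
    case (Suc n) then show ?case using Te[of "\<sigma> n"] by (auto simp: \<sigma>_Suc \<tau>_def)
  qed
  have Q: "?Q (\<sigma> n) (\<tau> n) (\<epsilon> n)" for n using Te[of "\<sigma> n"] \<sigma>[of n] by (simp add: \<tau>_def \<epsilon>_def)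
  have small: "\<exists>n. \<sigma> n < h" if "0 < h" for h
  proof -
    obtain n where "(1/2) ^ n < h / \<delta>"
      using real_arch_pow_inv[of "h/\<delta>" "1/2"] \<open>0 < h\<close> \<gamma>(1) by auto
    then have "\<delta> * (1/2) ^ n < h" using \<gamma>(1) by (simp add: field_simps)
    then show ?thesis using \<sigma>[of n] by (intro exI[of _ n]) linarith
  qed
  have "\<exists>r>0. \<forall>t. \<tau> n / 2 \<le> t \<longrightarrow> t \<le> \<delta> \<longrightarrow> r \<le> norm (\<gamma> t - x)" for n
  proof -
    have "0 < \<tau> n / 2" "\<tau> n / 2 \<le> \<delta>" using Q[of n] \<sigma>[of n] by auto
    from probe_dist_lower_bound[OF pr this] show ?thesis by metis
  qed
  then obtain \<rho> where \<rho>: "\<And>n. \<rho> n > 0" "\<And>n t. \<tau> n / 2 \<le> t \<Longrightarrow> t \<le> \<delta> \<Longrightarrow> \<rho> n \<le> norm (\<gamma> t - x)"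
    by metis
  \<comment> \<open>\<open>\<rho> n\<close> bounds the distance from \<open>x\<close> below wherever
    the \<open>n\<close>-th bump can be active, which makes \<open>c\<close> small relative to
    \<open>\<gamma> t - x\<close>; \<open>\<tau> n / 2\<close> is what the Lipschitz bound
    demands.\<close>
  define \<kappa> where "\<kappa> n = min (\<rho> n) (\<tau> n / 2)" for n
  have \<kappa>: "\<kappa> n > 0" for n using Q[of n] \<rho>(1)[of n] by (simp add: \<kappa>_def)
  have "\<exists>b\<in>B. dist b y < (1/2) ^ Suc n * ((1/2) ^ n * \<kappa> n)" for n
  proof -
    have "(1/2) ^ Suc n * ((1/2) ^ n * \<kappa> n) > 0" using \<kappa>[of n] by (intro mult_pos_pos) auto
    then show ?thesis using y unfolding closure_approachable by blast
  qed
  then obtain b where b: "\<And>n. b n \<in> B" "\<And>n. dist (b n) y < (1/2) ^ Suc n * ((1/2) ^ n * \<kappa> n)"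
    by metis
  obtain c where c: "1-lipschitz_on UNIV c" "c 0 = 0"
    "\<And>n t. \<tau> n \<le> t \<Longrightarrow> t \<le> \<sigma> n \<Longrightarrow> c t = b n - y"
    "\<And>N t K. (\<And>n. \<tau> n / 2 \<le> t \<Longrightarrow> \<kappa> n \<le> K) \<Longrightarrow> 0 \<le> K \<Longrightarrow> t \<le> \<tau> N / 2 \<Longrightarrow> norm (c t) \<le> (1/2) ^ N * K"
  proof (rule stepped_lipschitz_path[of \<tau> \<sigma> "\<lambda>n. b n - y" \<kappa>])
    show "norm (b n - y) \<le> (1/2) ^ Suc n * ((1/2) ^ n * \<kappa> n)" for n
      using b(2)[of n] unfolding dist_norm by (rule less_imp_le)
  qed (use Q in \<open>auto simp: \<sigma>_Suc \<kappa>_def\<close>)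
  define \<gamma>' where "\<gamma>' t = i (\<gamma> t) + j (y + c t)" for t
  let ?z = "i x + j y" and ?S = "sumset A B"
  \<comment> \<open>Through this identity injectivity and covering numbers pass from
    \<open>\<gamma>\<close> to \<open>\<gamma>'\<close>.\<close>
  have p\<gamma>': "p (\<gamma>' t) = \<gamma> t" for t by (simp add: \<gamma>'_def p_add)
  have \<gamma>'0: "\<gamma>' 0 = ?z" by (simp add: \<gamma>'_def \<gamma>(4) c(2))
  have \<gamma>'_S: "\<gamma>' t \<in> ?S" if "\<tau> n \<le> t" "t \<le> \<sigma> n" "\<gamma> t \<in> A" for n t
    using c(3)[OF that(1,2)] b(1)[of n] that(3) by (auto simp: \<gamma>'_def sumset_def)
  have lip: "(L + 1)-lipschitz_on {0..\<delta>} \<gamma>'"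
  proof (rule lipschitz_onI)
    fix t u assume tu: "t \<in> {0..\<delta>}" "u \<in> {0..\<delta>}"
    have "dist (\<gamma>' t) (\<gamma>' u) = norm (i (\<gamma> t - \<gamma> u) + j (c t - c u))"
      by (simp add: dist_norm \<gamma>'_def sumset_diff)
    also have "\<dots> \<le> norm (\<gamma> t - \<gamma> u) + norm (c t - c u)"
      using norm_triangle_ineq[of "i (\<gamma> t - \<gamma> u)" "j (c t - c u)"] by (simp add: norm_i norm_j)
    also have "\<dots> \<le> L * dist t u + 1 * dist t u"
      using lipschitz_onD[OF \<gamma>(3) tu] lipschitz_onD[OF c(1), of t u]
      by (intro add_mono) (auto simp: dist_norm)
    finally show "dist (\<gamma>' t) (\<gamma>' u) \<le> (L + 1) * dist t u" by (simp add: algebra_simps)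
  qed (use L0 in simp)
  have ne: "eventually (\<lambda>t. i (\<gamma> t - x) \<noteq> 0) (at_right 0)"
  proof (rule eventually_at_rightI[of 0 \<delta>])
    fix t assume t: "t \<in> {0<..<\<delta>}"
    then have "\<gamma> t \<noteq> \<gamma> 0" using inj_onD[OF \<gamma>(2), of t 0] by auto
    then show "i (\<gamma> t - x) \<noteq> 0" using norm_i[of "\<gamma> t - x"] \<gamma>(4) by auto
  qed (use \<gamma> in simp)
  have c_small: "((\<lambda>t. j (c t) /\<^sub>R norm (i (\<gamma> t - x))) \<longlongrightarrow> 0) (at_right 0)"
  proof (rule tendstoI)
    fix h :: real assume "h > 0"
    then obtain N where N: "(1/2) ^ N < h" using real_arch_pow_inv[of h "1/2"] by auto
    have tN: "eventually (\<lambda>t. t < \<tau> N / 2) (at_right 0)"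
      by (rule eventually_at_rightI[of 0 "\<tau> N / 2"]) (use Q in auto)
    show "eventually (\<lambda>t. dist (j (c t) /\<^sub>R norm (i (\<gamma> t - x))) 0 < h) (at_right 0)"
      using eventually_at_right_less[of "0::real"] ne tN
    proof eventually_elim
      case (elim t)
      have "\<tau> N / 2 \<le> \<delta>" using Q[of N] \<sigma>[of N] by auto
      \<comment> \<open>The bound \<open>K\<close> is taken to be
        \<open>norm (\<gamma> t - x)\<close>, which dominates \<open>\<kappa> n\<close> for every
        bump active at \<open>t\<close>.\<close>
      have "norm (c t) \<le> (1/2) ^ N * norm (\<gamma> t - x)"
      proof (rule c(4))
        fix n assume "\<tau> n / 2 \<le> t"
        then show "\<kappa> n \<le> norm (\<gamma> t - x)"
          using \<rho>(2)[of n t] elim \<open>\<tau> N / 2 \<le> \<delta>\<close> by (simp add: \<kappa>_def)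
      qed (use elim in auto)
      moreover have "norm (\<gamma> t - x) > 0" using elim linear_0[OF lin_i] by auto
      ultimately have "norm (c t) / norm (\<gamma> t - x) \<le> (1/2) ^ N"
        by (simp only: pos_divide_le_eq)
      moreover have "dist (j (c t) /\<^sub>R norm (i (\<gamma> t - x))) 0 = norm (c t) / norm (\<gamma> t - x)"
        by (simp add: norm_i norm_j divide_inverse_commute)
      ultimately show ?case using N by linarith
    qed
  qed
  have pr': "(\<gamma>', \<delta>) \<in> probes ?z ?S (i v)"
    unfolding probes_def mem_Collect_eq prod.case
  proof (intro conjI ballI)
    show "\<delta> > 0" by fact
    show "inj_on \<gamma>' {0..\<delta>}"
      using \<gamma>(2) by (metis inj_on_def p\<gamma>')
    show "\<exists>L. L-lipschitz_on {0..\<delta>} \<gamma>'" using lip by blast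
    show "\<gamma>' 0 = ?z" by fact
    have "((\<lambda>t. i (\<gamma> t - x) /\<^sub>R norm (i (\<gamma> t - x))) \<longlongrightarrow> i v) (at_right 0)"
      using tendsto_i[OF \<gamma>(5)] by (simp add: linear_scale[OF lin_i] norm_i)
    from tendsto_direction_add[OF this c_small ne]
    show "((\<lambda>t. (\<gamma>' t - ?z) /\<^sub>R norm (\<gamma>' t - ?z)) \<longlongrightarrow> i v) (at_right 0)"
      by (simp add: \<gamma>'_def sumset_diff)
    show "?S \<inter> \<gamma>' ` {0<..\<eta>} \<noteq> {}" if \<eta>: "\<eta> \<in> {0<..\<delta>}" for \<eta>
    proof -
      obtain n where n: "\<sigma> n < \<eta>" using small[of \<eta>] \<eta> by auto
      obtain t where t: "\<tau> n \<le> t" "t \<le> \<sigma> n" "\<gamma> t \<in> A" using Q[of n] by auto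
      have "t \<in> {0<..\<eta>}" using t n Q[of n] by auto
      then show ?thesis using \<gamma>'_S[OF t] by blast
    qed
  qed
  have "s \<le> dim_Pbox ?z (?S \<inter> \<gamma>' ` {0..\<delta>})"
  proof (rule dim_Pbox_ge)
    have near: "\<gamma>' t \<in> ball ?z r" if "0 \<le> t" "t \<le> \<sigma> n" "(L + 1) * \<sigma> n < r" for t n r
    proof -
      have "dist ?z (\<gamma>' t) \<le> (L + 1) * dist 0 t"
        using lipschitz_onD[OF lip, of 0 t] that \<sigma>[of n] \<gamma>(1) \<gamma>'0 by auto
      also have "\<dots> \<le> (L + 1) * \<sigma> n" using that L0 by (intro mult_left_mono) auto
      finally show ?thesis using that by simp
    qed
    have sm: "\<exists>n. \<sigma> n < h \<and> (L + 1) * \<sigma> n < r" if "h > 0" "r > 0" for h r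
      using small[of "min h (r / (L + 1))"] that L0 by (auto simp: field_simps)
    show "?z \<in> closure (?S \<inter> \<gamma>' ` {0..\<delta>})"
      unfolding closure_approachable
    proof (intro allI impI)
      fix r :: real assume "r > 0"
      then obtain n where n: "(L + 1) * \<sigma> n < r" using sm[of 1 r] by auto
      obtain t where t: "\<tau> n \<le> t" "t \<le> \<sigma> n" "\<gamma> t \<in> A" using Q[of n] by auto
      have t0: "0 \<le> t" "t \<le> \<delta>" using t Q[of n] \<sigma>[of n] by auto
      show "\<exists>u\<in>?S \<inter> \<gamma>' ` {0..\<delta>}. dist u ?z < r"
        using \<gamma>'_S[OF t] near[OF t0(1) t(2) n] t0
        by (intro bexI[of _ "\<gamma>' t"]) (auto simp: dist_commute)
    qed
    fix r h :: real assume "r > 0" "h > 0"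
    then obtain n where n: "\<sigma> n < min h 1" "(L + 1) * \<sigma> n < r" using sm[of "min h 1" r] by auto
    let ?E = "?S \<inter> \<gamma>' ` {0..\<delta>} \<inter> ball ?z r" and ?F = "A \<inter> \<gamma> ` {\<tau> n..\<sigma> n}"
    have e: "0 < \<epsilon> n" "\<epsilon> n < h" "\<epsilon> n < 1" using Q[of n] n by auto
    \<comment> \<open>On the \<open>n\<close>-th interval \<open>y + c\<close> is the constant
      \<open>b n\<close> in \<open>B\<close>, so each point of \<open>A\<close> on the chunk lifts
      to a point of the sumset on \<open>\<gamma>'\<close>. Since \<open>p\<close> does not expand
      distances, \<open>?E\<close> needs at least as many sets as the chunk.\<close>
    have "?F \<subseteq> p ` ?E"
    proof
      fix a assume "a \<in> ?F"
      then obtain t where t: "a = \<gamma> t" "\<tau> n \<le> t" "t \<le> \<sigma> n" "\<gamma> t \<in> A" by auto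
      have t0: "0 \<le> t" "t \<le> \<delta>" using t Q[of n] \<sigma>[of n] by auto
      have "\<gamma>' t \<in> ?E" using \<gamma>'_S[OF t(2-4)] near[OF t0(1) t(3) n(2)] t0 by auto
      then show "a \<in> p ` ?E" using p\<gamma>'[of t] t(1) by force
    qed
    moreover have bE: "bounded ?E" by (rule bounded_subset[OF bounded_ball]) blast
    moreover have bpE: "bounded (p ` ?E)"
      using bE lin_p by (simp add: bounded_linear_image linear_conv_bounded_linear)
    ultimately have le: "covering_number (\<epsilon> n) ?F \<le> covering_number (\<epsilon> n) ?E"
      using covering_number_mono[OF bpE e(1)] covering_number_image_le[OF bE e(1) dist_p_le]
      by (meson order_trans)
    have "bounded ?F" using \<open>?F \<subseteq> p ` ?E\<close> bpE by (rule bounded_subset[rotated])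
    then have "0 < covering_number (\<epsilon> n) ?F" by (rule covering_number_pos) (use Q[of n] in auto)
    then have "ln (real (covering_number (\<epsilon> n) ?F)) / ln (1 / \<epsilon> n)
        \<le> ln (real (covering_number (\<epsilon> n) ?E)) / ln (1 / \<epsilon> n)"
      using le e by (intro divide_right_mono) auto
    then have "s \<le> ennreal (ln (real (covering_number (\<epsilon> n) ?E)) / ln (1 / \<epsilon> n))"
      using Q[of n] by (meson ennreal_leI order_trans)
    then show "\<exists>\<epsilon>. 0 < \<epsilon> \<and> \<epsilon> < h \<and> s \<le> ennreal (ln (real (covering_number \<epsilon> ?E)) / ln (1 / \<epsilon>))"
      using e by blast
  qed
  also have "\<dots> \<le> theta ?z ?S (i v)"
    unfolding theta_def by (rule SUP_upper2[OF pr']) simp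
  finally show "s \<le> theta ?z ?S (i v)" .
qed

lemma theta_proj_sumset_ge:
  assumes "y \<in> closure B"
  shows "theta_proj x A \<xi> \<le> theta_proj (i x + j y) (sumset A B) (i ` \<xi>)"
  unfolding theta_proj_def
proof (rule SUP_least)
  fix w assume w: "w \<in> {w \<in> Eff x A. span {w} = \<xi>}"
  then have "i w \<in> {w \<in> Eff (i x + j y) (sumset A B). span {w} = i ` \<xi>}"
    using Eff_sumset[OF _ assms, of w x A] by (auto simp: span_i)
  then show "theta x A w \<le> (SUP w\<in>{w \<in> Eff (i x + j y) (sumset A B). span {w} = i ` \<xi>}.
      theta (i x + j y) (sumset A B) w)"
    by (rule SUP_upper2) (rule theta_sumset_ge[OF assms])
qed

lemma Eff_proj_sumset:
  assumes "\<xi> \<in> Eff_proj x A" "y \<in> closure B"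
  shows "i ` \<xi> \<in> Eff_proj (i x + j y) (sumset A B)"
  using assms Eff_sumset[OF _ assms(2)] by (force simp: Eff_proj_def span_i[symmetric])

end

section \<open>Products and the lower bound\<close>

interpretation inl: isometric_summand "\<lambda>u. (u, 0)" "\<lambda>w. (0, w)" fst
  by unfold_locales
     (auto simp: norm_fst_le norm_Pair linear_fst intro: linearI)

interpretation inr: isometric_summand "\<lambda>w. (0, w)" "\<lambda>u. (u, 0)" snd
  by unfold_locales
     (auto simp: norm_snd_le norm_Pair linear_snd intro: linearI)

lemma inl_sumset: "inl.sumset A B = A \<times> B"
  by (auto simp: inl.sumset_def)

lemma inr_sumset: "inr.sumset B A = A \<times> B"
  by (auto simp: inr.sumset_def image_iff)

text \<open>Adding a constant commutes with a supremum over a nonempty index set; this is used once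
  for each variable.\<close>

lemma ennreal_SUP_add_SUP_le:
  fixes f :: "'i \<Rightarrow> ennreal" and g :: "'j \<Rightarrow> ennreal"
  assumes "I \<noteq> {}" "J \<noteq> {}" "\<And>a b. a \<in> I \<Longrightarrow> b \<in> J \<Longrightarrow> f a + g b \<le> C"
  shows "(SUP a\<in>I. f a) + (SUP b\<in>J. g b) \<le> C"
proof -
  have "f a + (SUP b\<in>J. g b) \<le> C" if "a \<in> I" for a
  proof -
    have "(SUP b\<in>J. g b + f a) \<le> C"
      by (rule SUP_least) (use assms(3)[OF that] in \<open>simp add: add.commute\<close>)
    then show ?thesis
      unfolding ennreal_SUP_add_left[OF assms(2)] by (simp add: add.commute)
  qed
  then have "(SUP a\<in>I. f a + (SUP b\<in>J. g b)) \<le> C" by (rule SUP_least)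
  then show ?thesis unfolding ennreal_SUP_add_left[OF assms(1)] .
qed

lemma sum_lessThan_add:
  fixes f :: "nat \<Rightarrow> 'a::comm_monoid_add"
  shows "(\<Sum>m<k + l. f m) = (\<Sum>m<k. f m) + (\<Sum>m<l. f (k + m))"
  by (induction l) (simp_all add: ac_simps)

text \<open>The first coordinate of a linear relation involves only the first \<open>k\<close>
  vectors, the second only the last \<open>l\<close>.\<close>

lemma proj_independent_Times:
  assumes \<xi>: "proj_independent k \<xi>" and \<zeta>: "proj_independent l \<zeta>"
  shows "proj_independent (k + l)
    (\<lambda>m. if m < k then (\<lambda>u. (u, 0)) ` \<xi> m else (\<lambda>w. (0, w)) ` \<zeta> (m - k))"
  unfolding proj_independent_def independent_family_iff
proof (intro allI impI)
  fix v c m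
  assume v: "\<forall>m<k + l. v m \<in> (if m < k then (\<lambda>u. (u, 0)) ` \<xi> m else (\<lambda>w. (0, w)) ` \<zeta> (m - k)) \<and> v m \<noteq> 0"
    and c: "(\<Sum>m<k + l. c m *\<^sub>R v m) = 0" and m: "m < k + l"
  have v1: "fst (v m) \<in> \<xi> m" "fst (v m) \<noteq> 0" "snd (v m) = 0" if "m < k" for m
    using v[rule_format, of m] that by (auto simp: prod_eq_iff)
  have v2: "snd (v (k + m)) \<in> \<zeta> m" "snd (v (k + m)) \<noteq> 0" "fst (v (k + m)) = 0" if "m < l" for m
    using v[rule_format, of "k + m"] that by (auto simp: prod_eq_iff)
  have "0 = fst (\<Sum>m<k + l. c m *\<^sub>R v m)" using c by simp
  also have "\<dots> = (\<Sum>m<k. c m *\<^sub>R fst (v m))"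
    using v2(3) by (simp add: fst_sum sum_lessThan_add)
  finally have "\<forall>m<k. c m = 0"
    using \<xi>[unfolded proj_independent_def independent_family_iff, rule_format, of "\<lambda>m. fst (v m)" c] v1
    by auto
  moreover have "0 = snd (\<Sum>m<k + l. c m *\<^sub>R v m)" using c by simp
  moreover have "snd (\<Sum>m<k + l. c m *\<^sub>R v m) = (\<Sum>m<l. c (k + m) *\<^sub>R snd (v (k + m)))"
    using v1(3) by (simp add: snd_sum sum_lessThan_add)
  ultimately have "\<forall>m<l. c (k + m) = 0"
    using \<zeta>[unfolded proj_independent_def independent_family_iff, rule_format, of "\<lambda>m. snd (v (k + m))" "\<lambda>m. c (k + m)"] v2
    by auto
  then show "c m = 0" using \<open>\<forall>m<k. c m = 0\<close> m
    by (metis add_diff_inverse_nat nat_add_left_cancel_less)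
qed

text \<open>The concatenated family \<open>\<omega>\<close> is admissible for the product: it is
  independent, and its length respects the dimension bound because dimensions of factors
  add.\<close>

lemma dim_cross_Times_ge_sums:
  fixes x :: "'a::euclidean_space" and y :: "'b::euclidean_space"
  assumes x: "x \<in> closure A" and y: "y \<in> closure B"
    and k: "k \<le> DIM('a)" "\<And>m. m < k \<Longrightarrow> \<xi> m \<in> Eff_proj x A" "proj_independent k \<xi>"
    and l: "l \<le> DIM('b)" "\<And>m. m < l \<Longrightarrow> \<zeta> m \<in> Eff_proj y B" "proj_independent l \<zeta>"
  shows "(\<Sum>m<k. theta_proj x A (\<xi> m)) + (\<Sum>m<l. theta_proj y B (\<zeta> m)) \<le> dim_cross (x, y) (A \<times> B)"
proof -
  define \<omega> where "\<omega> = (\<lambda>m. if m < k then (\<lambda>u::'a. (u, 0::'b)) ` \<xi> m else (\<lambda>w::'b. (0::'a, w)) ` \<zeta> (m - k))"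
  have E: "\<omega> m \<in> Eff_proj (x, y) (A \<times> B)" if "m < k + l" for m
    using inl.Eff_proj_sumset[OF k(2) y, of m] inr.Eff_proj_sumset[OF l(2) x, of "m - k"] that
    by (auto simp: \<omega>_def inl_sumset inr_sumset)
  have "(\<Sum>m<k. theta_proj x A (\<xi> m)) + (\<Sum>m<l. theta_proj y B (\<zeta> m))
      \<le> (\<Sum>m<k. theta_proj (x, y) (A \<times> B) (\<omega> m)) + (\<Sum>m<l. theta_proj (x, y) (A \<times> B) (\<omega> (k + m)))"
  proof (intro add_mono sum_mono)
    show "theta_proj x A (\<xi> m) \<le> theta_proj (x, y) (A \<times> B) (\<omega> m)" if "m \<in> {..<k}" for m
      using inl.theta_proj_sumset_ge[OF y, of x A "\<xi> m"] that by (simp add: \<omega>_def inl_sumset)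
    show "theta_proj y B (\<zeta> m) \<le> theta_proj (x, y) (A \<times> B) (\<omega> (k + m))" if "m \<in> {..<l}" for m
      using inr.theta_proj_sumset_ge[OF x, of y B "\<zeta> m"] that by (simp add: \<omega>_def inr_sumset)
  qed
  also have "\<dots> = (\<Sum>m<k + l. theta_proj (x, y) (A \<times> B) (\<omega> m))" by (simp add: sum_lessThan_add)
  also have "\<dots> \<le> dim_cross (x, y) (A \<times> B)"
    unfolding dim_cross_def
    by (rule SUP_upper2[of "(k + l, \<omega>)"])
       (use k(1) l(1) E proj_independent_Times[OF k(3) l(3)] in \<open>auto simp: \<omega>_def\<close>)
  finally show ?thesis .
qed

theorem theorem4p24:
  fixes A :: "'a::euclidean_space set" and B :: "'b::euclidean_space set"
    and x :: 'a and y :: 'b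
  assumes "x \<in> closure A" and "y \<in> closure B"
  shows "dim_cross x A + dim_cross y B \<le> dim_cross (x, y) (A \<times> B) \<and>
         dim_cross (x, y) (A \<times> B) \<le> of_nat (dim_Ptan x A) + of_nat (dim_Ptan y B)"
proof
  show "dim_cross (x, y) (A \<times> B) \<le> of_nat (dim_Ptan x A) + of_nat (dim_Ptan y B)"
    using order_trans[OF dim_cross_le_dim_Ptan of_nat_mono[OF dim_Ptan_Times_le]]
    by simp
  \<comment> \<open>The empty family, \<open>k = 0\<close>, makes both index sets nonempty, as the
    splitting of the suprema requires.\<close>
  show "dim_cross x A + dim_cross y B \<le> dim_cross (x, y) (A \<times> B)"
    unfolding dim_cross_def[of x] dim_cross_def[of y]
    by (rule ennreal_SUP_add_SUP_le)
       (auto simp: proj_independent_def independent_empty intro!: dim_cross_Times_ge_sums[OF assms] exI[of _ 0])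
qed

end
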